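(* Let $(G,\cdot,\star)$ be a multiplicative Lie algebra and let $V$ be a finite-dimensional vector space over a field $\mathbb{K}$. Then $G$ acts on $V$ if and only if there exists a unique representation of $G$ on $V$.
   Context: Notation: in any group, ${}^{x}y=xyx^{-1}$. A multiplicative Lie algebra is a triple $(G,\cdot,\star)$ where $(G,\cdot)$ is a group and $\star$ is a binary operation on $G$ such that for all $x,y,z\in G$: (1) $x\star x=1$; (2) $x\star(y\cdot z)=(x\star y)\cdot{}^{y}(x\star z)$; (3) $(x\cdot y)\star z={}^{x}(y\star z)\cdot(x\star z)$; (4) $((x\star y)\star{}^{y}z)\cdot((y\star z)\star{}^{z}x)\cdot((z\star x)\star{}^{x}y)=1$; (5) ${}^{z}(x\star y)={}^{z}x\star{}^{z}y$. For a vector space $V$ over $\mathbb{K}$, $GL(V)$ denotes the group of invertible linear maps $V\to V$ and $\mathrm{End}(V)$ the set of linear maps $V\to V$. A representation of $G$ on $V$ is a pair $(\phi,\psi)$, where $\phi:G\to GL(V)$, $g\mapsto\phi_g$, is a group homomorphism and $\psi:G\to \mathrm{End}(V)$, $g\mapsto \psi_g$, is a map such that for all $g,g'\in G$ and $v\in V$: (1) $\psi_{gg'}(v)=\psi_{{}^{g}g'}(\phi_g(v))+\psi_g(v)$; (2) $\psi_{{}^{g}g'}(\phi_g(v))=\phi_g(\psi_{g'}(v))$; (3) $\psi_{g\star g'}(\phi_{g'}(v))=\psi_g(\psi_{g'}(v))-\psi_{{}^{g}g'}(\psi_g(v))$. For a finite-dimensional vector space $V$ over $\mathbb{K}$, one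 says that $G$ acts on $V$ if there exists a pair $(\theta,\delta)$ (called an action of $G$ on $V$) of maps $\theta,\delta:G\times V\to V$ such that for all $g,g'\in G$ and $v,v_1,v_2\in V$: (1) $\theta(1,v)=v$; (2) $\theta(g,v_1+v_2)=\theta(g,v_1)+\theta(g,v_2)$; (3) $\theta(gg',v)=\theta(g,\theta(g',v))$; (4) $\delta(g,v_1+v_2)=\delta(g,v_1)+\delta(g,v_2)$; (5) $\delta({}^{g}g',\theta(g,v))={}^{g}\delta(g',v)$, where for $w\in V$ the symbol ${}^{g}w$ means $\theta(g,w)$; (6) $\delta(gg',v)=\delta({}^{g}g',\theta(g,v))+\delta(g,v)$; (7) $\delta(g\star g',\theta(g',v))=\delta(g,\delta(g',v))-\delta({}^{g}g',\delta(g,v))$.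
   Formalization: Uniqueness is of the representation with φ_g=θ(g,·), ψ_g=δ(g,·) for a given action; absolute uniqueness is false. θ and δ must also commute with scalars, else complex conjugation is an action giving no representation. Without these, only existence of an action iff of a representation is stated. *)

theory Defs
  imports Complex_Main "HOL-Algebra.Group"
begin

record 'g mult_lie = "'g monoid" +
  star :: "'g \<Rightarrow> 'g \<Rightarrow> 'g" (infixl \<open>\<star>\<index>\<close> 70)

definition conj_by :: "('g, 'm) monoid_scheme \<Rightarrow> 'g \<Rightarrow> 'g \<Rightarrow> 'g" where
  "conj_by G x y = x \<otimes>\<^bsub>G\<^esub> y \<otimes>\<^bsub>G\<^esub> inv\<^bsub>G\<^esub> x"

locale multiplicative_lie_algebra = group G
  for G :: "('g, 'm) mult_lie_scheme" (structure) +
  assumes star_closed: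
      "\<lbrakk>x \<in> carrier G; y \<in> carrier G\<rbrakk> \<Longrightarrow> x \<star> y \<in> carrier G"
    and star_self: "x \<in> carrier G \<Longrightarrow> x \<star> x = \<one>"
    and star_mult_right:
      "\<lbrakk>x \<in> carrier G; y \<in> carrier G; z \<in> carrier G\<rbrakk>
        \<Longrightarrow> x \<star> (y \<otimes> z) = (x \<star> y) \<otimes> conj_by G y (x \<star> z)"
    and star_mult_left:
      "\<lbrakk>x \<in> carrier G; y \<in> carrier G; z \<in> carrier G\<rbrakk>
        \<Longrightarrow> (x \<otimes> y) \<star> z = conj_by G x (y \<star> z) \<otimes> (x \<star> z)"
    and star_jacobi:
      "\<lbrakk>x \<in> carrier G; y \<in> carrier G; z \<in> carrier G\<rbrakk>
        \<Longrightarrow> ((x \<star> y) \<star> conj_by G y z) \<otimes> ((y \<star> z) \<star> conj_by G z x)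
            \<otimes> ((z \<star> x) \<star> conj_by G x y) = \<one>"
    and conj_star:
      "\<lbrakk>x \<in> carrier G; y \<in> carrier G; z \<in> carrier G\<rbrakk>
        \<Longrightarrow> conj_by G z (x \<star> y) = conj_by G z x \<star> conj_by G z y"

definition End_space :: "('k::field \<Rightarrow> 'v::ab_group_add \<Rightarrow> 'v) \<Rightarrow> ('v \<Rightarrow> 'v) set" where
  "End_space scale = {f. Vector_Spaces.linear scale scale f}"

definition GL_space :: "('k::field \<Rightarrow> 'v::ab_group_add \<Rightarrow> 'v) \<Rightarrow> ('v \<Rightarrow> 'v) monoid" where
  "GL_space scale = \<lparr>carrier = {f \<in> End_space scale. bij f}, mult = (\<circ>), one = id\<rparr>"

text \<open>Maps with domain \<open>carrier G\<close> are taken to be extensional, so that equality of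
  representations (and hence their uniqueness) only concerns the values on \<open>carrier G\<close>.\<close>

definition mlie_representation ::
    "('g, 'm) mult_lie_scheme \<Rightarrow> ('k::field \<Rightarrow> 'v::ab_group_add \<Rightarrow> 'v)
      \<Rightarrow> ('g \<Rightarrow> 'v \<Rightarrow> 'v) \<Rightarrow> ('g \<Rightarrow> 'v \<Rightarrow> 'v) \<Rightarrow> bool" where
  "mlie_representation G scale \<phi> \<psi> \<longleftrightarrow>
     \<phi> \<in> hom G (GL_space scale) \<and> \<phi> \<in> extensional (carrier G) \<and>
     \<psi> \<in> carrier G \<rightarrow>\<^sub>E End_space scale \<and>
     (\<forall>g\<in>carrier G. \<forall>g'\<in>carrier G. \<forall>v.
        \<psi> (g \<otimes>\<^bsub>G\<^esub> g') v = \<psi> (conj_by G g g') (\<phi> g v) + \<psi> g v \<and>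
        \<psi> (conj_by G g g') (\<phi> g v) = \<phi> g (\<psi> g' v) \<and>
        \<psi> (g \<star>\<^bsub>G\<^esub> g') (\<phi> g' v) = \<psi> g (\<psi> g' v) - \<psi> (conj_by G g g') (\<psi> g v))"

definition mlie_action ::
    "('g, 'm) mult_lie_scheme \<Rightarrow> ('g \<times> 'v::ab_group_add \<Rightarrow> 'v) \<Rightarrow> ('g \<times> 'v \<Rightarrow> 'v) \<Rightarrow> bool" where
  "mlie_action G \<theta> \<delta> \<longleftrightarrow>
     (\<forall>g\<in>carrier G. \<forall>g'\<in>carrier G. \<forall>v v1 v2.
        \<theta> (\<one>\<^bsub>G\<^esub>, v) = v \<and>
        \<theta> (g, v1 + v2) = \<theta> (g, v1) + \<theta> (g, v2) \<and>
        \<theta> (g \<otimes>\<^bsub>G\<^esub> g', v) = \<theta> (g, \<theta> (g', v)) \<and>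
        \<delta> (g, v1 + v2) = \<delta> (g, v1) + \<delta> (g, v2) \<and>
        \<delta> (conj_by G g g', \<theta> (g, v)) = \<theta> (g, \<delta> (g', v)) \<and>
        \<delta> (g \<otimes>\<^bsub>G\<^esub> g', v) = \<delta> (conj_by G g g', \<theta> (g, v)) + \<delta> (g, v) \<and>
        \<delta> (g \<star>\<^bsub>G\<^esub> g', \<theta> (g', v)) = \<delta> (g, \<delta> (g', v)) - \<delta> (conj_by G g g', \<delta> (g, v)))"

text \<open>The axioms of an action only require additivity in the vector argument. An action by a
  non-\<open>K\<close>-linear map (complex conjugation on \<open>\<complex>\<close>, say) does not define a representation, so
  compatibility with scalars has to be required in addition.\<close>

definition scalar_compatible ::
    "('g, 'm) mult_lie_scheme \<Rightarrow> ('k::field \<Rightarrow> 'v::ab_group_add \<Rightarrow> 'v)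
      \<Rightarrow> ('g \<times> 'v \<Rightarrow> 'v) \<Rightarrow> bool" where
  "scalar_compatible G scale f \<longleftrightarrow>
     (\<forall>g\<in>carrier G. \<forall>c v. f (g, scale c v) = scale c (f (g, v)))"

definition corresponds ::
    "('g, 'm) mult_lie_scheme \<Rightarrow> ('g \<times> 'v \<Rightarrow> 'v) \<Rightarrow> ('g \<Rightarrow> 'v \<Rightarrow> 'v) \<Rightarrow> bool" where
  "corresponds G f \<rho> \<longleftrightarrow> (\<forall>g\<in>carrier G. \<forall>v. \<rho> g v = f (g, v))"

end

theory Submission
  imports Defs
begin

text \<open>An action and a representation are the same data, curried: put
  \<open>\<phi> g v = \<theta> (g, v)\<close> and \<open>\<psi> g v = \<delta> (g, v)\<close> on the
  carrier. The laws relating the two maps then agree term by term, and additivity together with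
  scalar compatibility is linearity. What remains is that an action never mentions invertibility,
  while a representation never mentions the unit law; \<open>hom_GL_space_iff\<close> shows that
  these conditions can be traded for each other, and \<open>mlie_representation_iff_action\<close>
  assembles the dictionary. Uniqueness comes from \<open>corresponds_extensional_iff\<close>: the
  action prescribes the curried maps on the carrier, and extensionality prescribes them elsewhere.
  The bare existence statements are equivalent because the trivial action witnesses both.\<close>

lemma (in group) conj_by_closed [simp, intro]:
  "x \<in> carrier G \<Longrightarrow> y \<in> carrier G \<Longrightarrow> conj_by G x y \<in> carrier G"
  by (simp add: conj_by_def)

lemma End_space_iff:
  assumes "vector_space scale"
  shows "f \<in> End_space scale \<longleftrightarrow>
    (\<forall>u v. f (u + v) = f u + f v) \<and> (\<forall>c v. f (scale c v) = scale c (f v))"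
  using assms by (auto simp: End_space_def Vector_Spaces.linear_iff)

text \<open>Given multiplicativity, bijectivity of every \<open>\<phi> g\<close> amounts to
  \<open>\<phi> \<one>\<close> being the identity, which is the form in which an action states
  it.\<close>

lemma (in group) hom_GL_space_iff:
  "\<phi> \<in> hom G (GL_space scale) \<longleftrightarrow>
    (\<forall>g\<in>carrier G. \<phi> g \<in> End_space scale) \<and> (\<forall>v. \<phi> \<one> v = v) \<and>
    (\<forall>g\<in>carrier G. \<forall>h\<in>carrier G. \<forall>v. \<phi> (g \<otimes> h) v = \<phi> g (\<phi> h v))"
  (is "?L \<longleftrightarrow> ?R")
proof
  assume L: ?L
  then have mult: "\<phi> (g \<otimes> h) = \<phi> g \<circ> \<phi> h" if "g \<in> carrier G" "h \<in> carrier G" for g h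
    using that by (simp add: hom_def GL_space_def)
  from L have carr: "\<phi> g \<in> End_space scale" "bij (\<phi> g)" if "g \<in> carrier G" for g
    using that by (auto simp: hom_def GL_space_def)
  \<comment> \<open>\<open>\<phi> \<one>\<close> is idempotent, and an injective idempotent map is
    the identity.\<close>
  have "\<phi> \<one> (\<phi> \<one> v) = \<phi> \<one> v" for v
    using mult[of \<one> \<one>] by (metis comp_apply one_closed l_one)
  then have "\<phi> \<one> v = v" for v
    using carr(2)[OF one_closed] by (meson bij_is_inj injD)
  then show ?R
    using mult carr(1) by simp
next
  assume R: ?R
  \<comment> \<open>The two-sided inverse of \<open>\<phi> g\<close> is
    \<open>\<phi> (inv g)\<close>.\<close>
  have bij: "bij (\<phi> g)" if g: "g \<in> carrier G" for g
  proof (rule o_bij)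
    have mult: "\<phi> (h \<otimes> k) v = \<phi> h (\<phi> k v)" if "h \<in> carrier G" "k \<in> carrier G" for h k v
      using R that by blast
    have one: "\<phi> \<one> v = v" for v
      using R by blast
    show "\<phi> (inv g) \<circ> \<phi> g = id"
      using g by (simp add: fun_eq_iff one flip: mult)
    show "\<phi> g \<circ> \<phi> (inv g) = id"
      using g by (simp add: fun_eq_iff one flip: mult)
  qed
  then show ?L
    using R by (simp add: hom_def GL_space_def fun_eq_iff)
qed

text \<open>Separates the jointly quantified laws of \<open>mlie_action\<close>, giving each only
  the variables it mentions, and puts \<open>P\<close> before \<open>N\<close> as in
  \<open>mlie_representation\<close>. The law \<open>A\<close> loses both group variables, so the
  element \<open>a\<close> is there to instantiate them.\<close>

lemma ball2_conj_split:
  assumes "a \<in> C"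
  shows "(\<forall>g\<in>C. \<forall>h\<in>C. \<forall>v u w.
      A v \<and> B g u w \<and> M g h v \<and> D g u w \<and> N g h v \<and> P g h v \<and> Q g h v) \<longleftrightarrow>
    (\<forall>v. A v) \<and> (\<forall>g\<in>C. \<forall>u w. B g u w) \<and> (\<forall>g\<in>C. \<forall>h\<in>C. \<forall>v. M g h v) \<and>
    (\<forall>g\<in>C. \<forall>u w. D g u w) \<and> (\<forall>g\<in>C. \<forall>h\<in>C. \<forall>v. P g h v \<and> N g h v \<and> Q g h v)"
  using assms by blast

lemma mlie_representation_iff_action:
  fixes G (structure)
  assumes "multiplicative_lie_algebra G" and vs: "vector_space scale"
    and ext: "\<phi> \<in> extensional (carrier G)" "\<psi> \<in> extensional (carrier G)"
    and corr: "corresponds G \<theta> \<phi>" "corresponds G \<delta> \<psi>"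
  shows "mlie_representation G scale \<phi> \<psi> \<longleftrightarrow>
    mlie_action G \<theta> \<delta> \<and> scalar_compatible G scale \<theta> \<and> scalar_compatible G scale \<delta>"
proof -
  interpret multiplicative_lie_algebra G by fact
  have eq: "\<phi> g v = \<theta> (g, v)" "\<psi> g v = \<delta> (g, v)" if "g \<in> carrier G" for g v
    using that corr by (simp_all add: corresponds_def)
  have End: "\<phi> g \<in> End_space scale \<longleftrightarrow>
      (\<forall>u v. \<theta> (g, u + v) = \<theta> (g, u) + \<theta> (g, v)) \<and>
      (\<forall>c v. \<theta> (g, scale c v) = scale c (\<theta> (g, v)))"
    "\<psi> g \<in> End_space scale \<longleftrightarrow>
      (\<forall>u v. \<delta> (g, u + v) = \<delta> (g, u) + \<delta> (g, v)) \<and>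
      (\<forall>c v. \<delta> (g, scale c v) = scale c (\<delta> (g, v)))" if "g \<in> carrier G" for g
    using that by (simp_all add: End_space_iff[OF vs] eq)
  have hom: "\<phi> \<in> hom G (GL_space scale) \<longleftrightarrow>
      (\<forall>g\<in>carrier G. (\<forall>u v. \<theta> (g, u + v) = \<theta> (g, u) + \<theta> (g, v)) \<and>
        (\<forall>c v. \<theta> (g, scale c v) = scale c (\<theta> (g, v)))) \<and>
      (\<forall>v. \<theta> (\<one>, v) = v) \<and>
      (\<forall>g\<in>carrier G. \<forall>h\<in>carrier G. \<forall>v. \<theta> (g \<otimes> h, v) = \<theta> (g, \<theta> (h, v)))"
    by (simp add: hom_GL_space_iff End eq)
  have PiE: "\<psi> \<in> carrier G \<rightarrow>\<^sub>E End_space scale \<longleftrightarrow>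
      (\<forall>g\<in>carrier G. (\<forall>u v. \<delta> (g, u + v) = \<delta> (g, u) + \<delta> (g, v)) \<and>
        (\<forall>c v. \<delta> (g, scale c v) = scale c (\<delta> (g, v))))"
    using ext(2) by (simp add: PiE_def Pi_def End Ball_def)
  have laws: "(\<forall>g\<in>carrier G. \<forall>g'\<in>carrier G. \<forall>v.
        \<psi> (g \<otimes> g') v = \<psi> (conj_by G g g') (\<phi> g v) + \<psi> g v \<and>
        \<psi> (conj_by G g g') (\<phi> g v) = \<phi> g (\<psi> g' v) \<and>
        \<psi> (g \<star> g') (\<phi> g' v) = \<psi> g (\<psi> g' v) - \<psi> (conj_by G g g') (\<psi> g v)) \<longleftrightarrow>
      (\<forall>g\<in>carrier G. \<forall>g'\<in>carrier G. \<forall>v.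
        \<delta> (g \<otimes> g', v) = \<delta> (conj_by G g g', \<theta> (g, v)) + \<delta> (g, v) \<and>
        \<delta> (conj_by G g g', \<theta> (g, v)) = \<theta> (g, \<delta> (g', v)) \<and>
        \<delta> (g \<star> g', \<theta> (g', v)) = \<delta> (g, \<delta> (g', v)) - \<delta> (conj_by G g g', \<delta> (g, v)))"
    \<comment> \<open>The congruence rule supplies membership of \<open>g\<close> and
      \<open>g'\<close>; closure then lets \<open>eq\<close> apply at products, conjugates and star
      products too.\<close>
    by (simp only: eq conj_by_closed m_closed star_closed cong: ball_cong)
  have act: "mlie_action G \<theta> \<delta> \<longleftrightarrow>
      (\<forall>v. \<theta> (\<one>, v) = v) \<and>
      (\<forall>g\<in>carrier G. \<forall>u v. \<theta> (g, u + v) = \<theta> (g, u) + \<theta> (g, v)) \<and>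
      (\<forall>g\<in>carrier G. \<forall>h\<in>carrier G. \<forall>v. \<theta> (g \<otimes> h, v) = \<theta> (g, \<theta> (h, v))) \<and>
      (\<forall>g\<in>carrier G. \<forall>u v. \<delta> (g, u + v) = \<delta> (g, u) + \<delta> (g, v)) \<and>
      (\<forall>g\<in>carrier G. \<forall>g'\<in>carrier G. \<forall>v.
        \<delta> (g \<otimes> g', v) = \<delta> (conj_by G g g', \<theta> (g, v)) + \<delta> (g, v) \<and>
        \<delta> (conj_by G g g', \<theta> (g, v)) = \<theta> (g, \<delta> (g', v)) \<and>
        \<delta> (g \<star> g', \<theta> (g', v)) = \<delta> (g, \<delta> (g', v)) - \<delta> (conj_by G g g', \<delta> (g, v)))"
    unfolding mlie_action_def by (rule ball2_conj_split[OF one_closed])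
  show ?thesis
    unfolding mlie_representation_def scalar_compatible_def hom PiE laws act
    unfolding ball_conj_distrib all_conj_distrib
    by (simp only: ext(1) simp_thms conj_ac)
qed

text \<open>Correspondence fixes the values on the carrier and extensionality those outside it, so
  exactly one map satisfies both. This is the source of uniqueness.\<close>

lemma corresponds_extensional_iff:
  "\<rho> \<in> extensional (carrier G) \<and> corresponds G f \<rho> \<longleftrightarrow>
    \<rho> = restrict (\<lambda>g v. f (g, v)) (carrier G)"
  by (auto simp: corresponds_def extensional_def restrict_def fun_eq_iff)

lemma mlie_representation_extensional:
  assumes "mlie_representation G scale \<phi> \<psi>"
  shows "\<phi> \<in> extensional (carrier G)" "\<psi> \<in> extensional (carrier G)"
  using assms by (auto simp: mlie_representation_def PiE_def)

theorem theorem3p20: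
  fixes G :: "('g, 'm) mult_lie_scheme"
    and scale :: "'k::field \<Rightarrow> 'v::ab_group_add \<Rightarrow> 'v"
    and Basis :: "'v set"
  assumes "multiplicative_lie_algebra G"
    and "finite_dimensional_vector_space scale Basis"
  shows "((\<exists>(\<theta> :: 'g \<times> 'v \<Rightarrow> 'v) \<delta>. mlie_action G \<theta> \<delta>)
            \<longleftrightarrow> (\<exists>\<phi> \<psi>. mlie_representation G scale \<phi> \<psi>))
       \<and> (\<forall>(\<theta> :: 'g \<times> 'v \<Rightarrow> 'v) \<delta>.
            (mlie_action G \<theta> \<delta> \<and> scalar_compatible G scale \<theta> \<and> scalar_compatible G scale \<delta>)
            \<longleftrightarrow> (\<exists>!(\<phi>, \<psi>). mlie_representation G scale \<phi> \<psi>
                  \<and> corresponds G \<theta> \<phi> \<and> corresponds G \<delta> \<psi>))"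
proof -
  have vs: "vector_space scale"
    using assms(2) by (simp add: finite_dimensional_vector_space_def)
  define R where "R f = restrict (\<lambda>g v. f (g, v)) (carrier G)" for f :: "'g \<times> 'v \<Rightarrow> 'v"
  have R: "R f \<in> extensional (carrier G)" "corresponds G f (R f)" for f
    using corresponds_extensional_iff[of "R f" G f] by (simp_all add: R_def)
  have rep_R: "mlie_representation G scale (R \<theta>) (R \<delta>) \<longleftrightarrow>
      mlie_action G \<theta> \<delta> \<and> scalar_compatible G scale \<theta> \<and> scalar_compatible G scale \<delta>" for \<theta> \<delta>
    by (rule mlie_representation_iff_action[OF assms(1) vs R(1) R(1) R(2) R(2)])
  \<comment> \<open>The right side is a condition free of \<open>\<phi>\<close> and
    \<open>\<psi>\<close> together with equations determining both, so unique existence reduces to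
    that condition.\<close>
  have rep: "mlie_representation G scale \<phi> \<psi> \<and> corresponds G \<theta> \<phi> \<and> corresponds G \<delta> \<psi> \<longleftrightarrow>
      mlie_representation G scale (R \<theta>) (R \<delta>) \<and> \<phi> = R \<theta> \<and> \<psi> = R \<delta>" for \<phi> \<psi> \<theta> \<delta>
    using mlie_representation_extensional[of G scale \<phi> \<psi>] R(2)
      corresponds_extensional_iff[of \<phi> G \<theta>] corresponds_extensional_iff[of \<psi> G \<delta>]
    unfolding R_def[symmetric] by blast
  \<comment> \<open>Scalar compatibility is absent from the first equivalence, but both of its sides hold
    outright: every \<open>G\<close> acts by \<open>\<theta> (g, v) = v\<close> and \<open>\<delta> (g, v) = 0\<close>.\<close>
  have trivial_action: "mlie_action G (snd :: 'g \<times> 'v \<Rightarrow> 'v) (\<lambda>_. 0)"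
    by (simp add: mlie_action_def)
  moreover have "scalar_compatible G scale (snd :: 'g \<times> 'v \<Rightarrow> 'v)"
    "scalar_compatible G scale ((\<lambda>_. 0) :: 'g \<times> 'v \<Rightarrow> 'v)"
    \<comment> \<open>Distributivity at \<open>0 + 0\<close> yields \<open>scale c 0 = 0\<close>, as
      the zero map requires.\<close>
    using vector_space.vector_space_assms(1)[OF vs, of _ 0 0]
    by (simp_all add: scalar_compatible_def)
  ultimately have "mlie_representation G scale (R snd) (R (\<lambda>_. 0))"
    by (simp add: rep_R)
  then have "(\<exists>(\<theta> :: 'g \<times> 'v \<Rightarrow> 'v) \<delta>. mlie_action G \<theta> \<delta>) \<longleftrightarrow>
      (\<exists>\<phi> \<psi>. mlie_representation G scale \<phi> \<psi>)"
    using trivial_action by blast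
  moreover have "(\<exists>!(\<phi>, \<psi>). mlie_representation G scale \<phi> \<psi> \<and>
        corresponds G \<theta> \<phi> \<and> corresponds G \<delta> \<psi>) \<longleftrightarrow>
      mlie_action G \<theta> \<delta> \<and> scalar_compatible G scale \<theta> \<and> scalar_compatible G scale \<delta>" for \<theta> \<delta>
    unfolding rep rep_R by auto
  ultimately show ?thesis
    by blast
qed

end
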